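(* Let $n\ge 2$, $2\le k\le n$, and $\tau\in\mathcal T$. Let $f$ be a function on $S^n$ and set $$g(x)=\frac{2^{k-1}\,(f\circ\nu)(x)}{(|x|^2+1)^{k-1}},\qquad x\in\mathbb R^n .$$ Then $$(\mathfrak S f)(\tau\cap S^n)=(R_{k-1}g)(\tau\cap\mathbb R^n),$$ provided that either side of this equality exists in the Lebesgue sense.
   Context: $S^n$ is the unit sphere in $\mathbb R^{n+1}$, $e_1,\dots,e_{n+1}$ are the coordinate unit vectors, $N=(0,\dots,0,1)=e_{n+1}$ is the north pole, and $\mathbb R^n=\mathbb R e_1\oplus\cdots\oplus\mathbb R e_n\subset\mathbb R^{n+1}$. $\mathcal T$ is the manifold of all $k$-dimensional affine planes $\tau$ in $\mathbb R^{n+1}$ passing through $N$ and intersecting $\mathbb R^n$ (so $\tau\cap\mathbb R^n$ is a $(k-1)$-dimensional affine plane in $\mathbb R^n$ and $\tau\cap S^n$ is a $(k-1)$-dimensional sphere). The spherical slice transform of $f$ is $(\mathfrak S f)(\tau\cap S^n)=\int_{\tau\cap S^n} f(\eta)\,dS_\tau(\eta)$, $\tau\in\mathcal T$, where $dS_\tau$ is the standard surface area measure on the subsphere $\tau\cap S^n$. The Radon-John transform of a function $g$ on $\mathbb R^n$ is $(R_{k-1}g)(\zeta)=\int_\zeta g(x)\,d_\zeta x$, where $\zeta$ is a $(k-1)$-dimensional affine plane in $\mathbb R^n$ and $d_\zeta x$ is the standard Euclidean measure on $\zeta$. The map $\nu:\mathbb R^n\to S^n\setminus\{N\}$ is the bijection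 (inverse of the stereographic projection from $N$) $\nu(x)=\dfrac{2x+(|x|^2-1)e_{n+1}}{|x|^2+1}$. *)

theory Defs
  imports "HOL-Analysis.Analysis"
begin

section \<open>Euclidean measure on affine planes\<close>

definition plane_frame :: "'a::euclidean_space set \<Rightarrow> 'a \<Rightarrow> 'a set \<Rightarrow> bool" where
  "plane_frame \<zeta> p B \<longleftrightarrow>
     pairwise orthogonal B \<and> (\<forall>b\<in>B. norm b = 1) \<and> \<zeta> = (\<lambda>v. p + v) ` span B"

lemma plane_frame_exists:
  assumes "affine \<zeta>" "\<zeta> \<noteq> {}"
  shows "\<exists>p B. plane_frame \<zeta> p B"
proof -
  obtain p where p: "p \<in> \<zeta>" using assms by auto
  have "subspace ((\<lambda>x. - p + x) ` \<zeta>)"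
    using affine_diffs_subspace[OF assms(1) p] .
  from orthonormal_basis_subspace[OF this] obtain B where
    B: "pairwise orthogonal B" "\<And>x. x \<in> B \<Longrightarrow> norm x = 1" "span B = (\<lambda>x. - p + x) ` \<zeta>"
    by metis
  have "(\<lambda>v. p + v) ` span B = \<zeta>" by (simp add: B(3) image_image)
  with B show ?thesis unfolding plane_frame_def by metis
qed

text \<open>
  The \<open>d\<close>-dimensional Lebesgue measure carried by a \<open>d\<close>-dimensional affine plane
  \<open>\<zeta>\<close>, as a Borel measure on the ambient space: the image of the \<open>d\<close>-fold product of
  one-dimensional Lebesgue measure under the isometric coordinates of \<open>\<zeta>\<close> given by an
  orthonormal frame. This is the definition of \<^const>\<open>lborel\<close> with \<^const>\<open>Basis\<close>
  replaced by the frame. The choice of frame is immaterial, because Lebesgue measure is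
  invariant under rigid motions.
\<close>

definition plane_lborel :: "'a::euclidean_space set \<Rightarrow> 'a measure" where
  "plane_lborel \<zeta> =
     (let (p, B) = (SOME (p, B). plane_frame \<zeta> p B)
      in distr (\<Pi>\<^sub>M b\<in>B. (lborel :: real measure)) borel (\<lambda>t. p + (\<Sum>b\<in>B. t b *\<^sub>R b)))"

definition plane_lebesgue :: "'a::euclidean_space set \<Rightarrow> 'a measure" where
  "plane_lebesgue \<zeta> = completion (plane_lborel \<zeta>)"


section \<open>Surface area on subspheres\<close>

text \<open>
  Surface area on the sphere with centre \<open>c\<close> and radius \<open>r\<close> in the \<open>k\<close>-dimensional
  plane \<open>\<tau> \<ni> c\<close>: the area of \<open>A\<close> is \<open>k / r\<close> times the \<open>k\<close>-dimensional volume of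
  the open solid cone \<open>{c + t (y - c) | y \<in> A, 0 < t < 1}\<close>. That cone is the preimage
  of \<open>A\<close> in the ball under the radial projection from \<open>c\<close> to the sphere. (The
  projection sends \<open>c\<close> to \<open>c\<close>, but \<open>{c}\<close> is a null set.) The total mass is
  \<open>k \<omega> r^(k-1)\<close>, where \<open>\<omega>\<close> is the volume of the unit ball of dimension \<open>k\<close>.
\<close>

definition subsphere_borel :: "'a::euclidean_space set \<Rightarrow> 'a \<Rightarrow> real \<Rightarrow> 'a measure" where
  "subsphere_borel \<tau> c r =
     scale_measure (ennreal (of_int (aff_dim \<tau>) / r))
       (distr (restrict_space (plane_lborel \<tau>) (ball c r)) borel
          (\<lambda>y. c + (r / dist y c) *\<^sub>R (y - c)))"

definition slice_centre :: "'a::euclidean_space set \<Rightarrow> 'a" where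
  "slice_centre \<tau> = closest_point \<tau> 0"

definition slice_radius :: "'a::euclidean_space set \<Rightarrow> real" where
  "slice_radius \<tau> = sqrt (1 - (norm (slice_centre \<tau>))\<^sup>2)"

lemma slice_centre_pythagoras:
  fixes \<tau> :: "'a::euclidean_space set"
  assumes "affine \<tau>" "y \<in> \<tau>"
  shows "slice_centre \<tau> \<in> \<tau>" "slice_centre \<tau> \<bullet> (y - slice_centre \<tau>) = 0"
    "(norm y)\<^sup>2 = (norm (slice_centre \<tau>))\<^sup>2 + (dist (slice_centre \<tau>) y)\<^sup>2"
proof -
  let ?c = "slice_centre \<tau>"
  have cl: "closed \<tau>" and cv: "convex \<tau>"
    using assms(1) by (simp_all add: affine_closed affine_imp_convex)
  show c: "?c \<in> \<tau>"
    unfolding slice_centre_def using closest_point_in_set[OF cl] assms(2) by blast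
  have z: "2 *\<^sub>R ?c + (-1) *\<^sub>R y \<in> \<tau>"
    using assms c by (intro mem_affine) auto
  have "(0 - ?c) \<bullet> (y - ?c) \<le> 0" "(0 - ?c) \<bullet> (2 *\<^sub>R ?c + (-1) *\<^sub>R y - ?c) \<le> 0"
    unfolding slice_centre_def
    using closest_point_dot[OF cv cl assms(2), of 0]
      closest_point_dot[OF cv cl z, of 0] by (simp_all add: slice_centre_def)
  then show orth: "?c \<bullet> (y - ?c) = 0"
    by (simp add: inner_diff_right inner_add_right)
  have "y = ?c + (y - ?c)" by simp
  then have "(norm y)\<^sup>2 = (norm (?c + (y - ?c)))\<^sup>2" by simp
  also have "\<dots> = (norm ?c)\<^sup>2 + (norm (y - ?c))\<^sup>2"
    by (rule norm_add_Pythagorean) (simp add: orth orthogonal_def)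
  finally show "(norm y)\<^sup>2 = (norm ?c)\<^sup>2 + (dist ?c y)\<^sup>2"
    by (simp add: dist_norm norm_minus_commute)
qed

lemma slice_eq_subsphere:
  fixes \<tau> :: "'a::euclidean_space set"
  assumes "affine \<tau>" "\<tau> \<inter> sphere 0 1 \<noteq> {}"
  shows "\<tau> \<inter> sphere 0 1 = \<tau> \<inter> sphere (slice_centre \<tau>) (slice_radius \<tau>)"
proof -
  let ?c = "slice_centre \<tau>"
  obtain z where "z \<in> \<tau>" "norm z = 1" using assms(2) by auto
  then have "1 = (norm ?c)\<^sup>2 + (dist ?c z)\<^sup>2"
    using slice_centre_pythagoras(3)[OF assms(1)] by fastforce
  then have c1: "(norm ?c)\<^sup>2 \<le> 1" by (smt (verit) zero_le_power2)
  have "norm y = 1 \<longleftrightarrow> dist ?c y = slice_radius \<tau>" if "y \<in> \<tau>" for y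
  proof -
    have nn: "0 \<le> slice_radius \<tau>" using c1 by (simp add: slice_radius_def)
    have "norm y = 1 \<longleftrightarrow> (norm y)\<^sup>2 = 1"
      by (simp add: power2_eq_1_iff) (smt (verit) norm_ge_zero)
    also have "\<dots> \<longleftrightarrow> (dist ?c y)\<^sup>2 = (slice_radius \<tau>)\<^sup>2"
      using slice_centre_pythagoras(3)[OF assms(1) that] c1 by (auto simp: slice_radius_def)
    also have "\<dots> \<longleftrightarrow> dist ?c y = slice_radius \<tau>"
      by (rule power2_eq_iff_nonneg[OF zero_le_dist nn])
    finally show ?thesis .
  qed
  then show ?thesis by auto
qed

text \<open>The measure \<open>dS\<^sub>\<tau>\<close> on the intersection of \<open>\<tau>\<close> with the unit sphere.\<close>

definition slice_measure :: "'a::euclidean_space set \<Rightarrow> 'a measure" where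
  "slice_measure \<tau> = completion (subsphere_borel \<tau> (slice_centre \<tau>) (slice_radius \<tau>))"


section \<open>The two transforms\<close>

text \<open>
  With \<open>n = CARD('n)\<close>, the space \<open>(real^'n) \<times> real\<close> with its Euclidean product norm
  is \<open>\<real>\<^sup>n\<^sup>+\<^sup>1\<close>; the second component is the coordinate along \<open>e\<^sub>n\<^sub>+\<^sub>1\<close>, and \<open>x \<in> \<real>\<^sup>n\<close>
  is identified with \<open>(x, 0)\<close>.
\<close>

definition north_pole :: "(real^'n) \<times> real" where
  "north_pole = (0, 1)"

definition slice_planes :: "nat \<Rightarrow> ((real^'n) \<times> real) set set" where
  "slice_planes k =
     {\<tau>. affine \<tau> \<and> aff_dim \<tau> = int k \<and> north_pole \<in> \<tau> \<and> (\<exists>x. (x, 0) \<in> \<tau>)}"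

definition equatorial_section :: "((real^'n) \<times> real) set \<Rightarrow> (real^'n) set" where
  "equatorial_section \<tau> = {x. (x, 0) \<in> \<tau>}"

definition inv_stereographic :: "real^'n \<Rightarrow> (real^'n) \<times> real" where
  "inv_stereographic x =
     (1 / ((norm x)\<^sup>2 + 1)) *\<^sub>R (2 *\<^sub>R (x, 0) + ((norm x)\<^sup>2 - 1) *\<^sub>R north_pole)"

text \<open>
  Existence in the Lebesgue sense is absolute integrability with respect to the completed
  measure. Only the values of \<open>f\<close> on the unit sphere matter.
\<close>

definition slice_transform_exists ::
  "((real^'n) \<times> real \<Rightarrow> 'b::{banach, second_countable_topology})
     \<Rightarrow> ((real^'n) \<times> real) set \<Rightarrow> bool" where
  "slice_transform_exists f \<tau> \<longleftrightarrow> set_integrable (slice_measure \<tau>) (\<tau> \<inter> sphere 0 1) f"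

definition slice_transform ::
  "((real^'n) \<times> real \<Rightarrow> 'b::{banach, second_countable_topology})
     \<Rightarrow> ((real^'n) \<times> real) set \<Rightarrow> 'b" where
  "slice_transform f \<tau> = (LINT \<eta>:\<tau> \<inter> sphere 0 1|slice_measure \<tau>. f \<eta>)"

text \<open>The order of the Radon-John transform is the dimension of its argument \<open>\<zeta>\<close>.\<close>

definition radon_john_exists ::
  "(real^'n \<Rightarrow> 'b::{banach, second_countable_topology}) \<Rightarrow> (real^'n) set \<Rightarrow> bool" where
  "radon_john_exists g \<zeta> \<longleftrightarrow> set_integrable (plane_lebesgue \<zeta>) \<zeta> g"

definition radon_john ::
  "(real^'n \<Rightarrow> 'b::{banach, second_countable_topology}) \<Rightarrow> (real^'n) set \<Rightarrow> 'b" where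
  "radon_john g \<zeta> = (LINT x:\<zeta>|plane_lebesgue \<zeta>. g x)"

end

theory Submission
  imports Defs "HOL-Probability.Distributions" "HOL-Real_Asymp.Real_Asymp"
begin

text \<open>
  Write \<open>c\<close> and \<open>r\<close> for the centre and radius of the subsphere \<open>\<tau> \<inter> S\<^sup>n\<close>, \<open>N\<close> for the north
  pole, \<open>m = k - 1\<close> and \<open>\<zeta>\<close> for the equatorial section of \<open>\<tau>\<close>. The map \<open>\<nu>\<close> is the
  restriction to \<open>\<real>\<^sup>n\<close> of the inversion with centre \<open>N\<close> that exchanges \<open>\<real>\<^sup>n\<close> and the sphere.
  It preserves every plane through \<open>N\<close>, so it maps \<open>\<zeta>\<close> onto the subsphere without \<open>N\<close>, and
  the theorem says that surface area on the subsphere is the image under \<open>\<nu>\<close> of the measure with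
  density \<open>(2 / (|x|\<^sup>2 + 1))^m\<close> on \<open>\<zeta>\<close>. This is
  \<open>subsphere_borel_eq_stereographic_image\<close>.

  Since \<open>c\<close> is the point of \<open>\<tau>\<close> closest to the origin, \<open>N - c\<close> is orthogonal to \<open>\<zeta>\<close>.
  Put \<open>u = (N - c) / r\<close>, a unit vector. Then \<open>\<zeta> = {p + w | w \<in> V}\<close> with
  \<open>p = N - u / r\<close> and a subspace \<open>V\<close> orthogonal to \<open>u\<close>, and \<open>|x|\<^sup>2 + 1 = |w|\<^sup>2 + 1 / r\<^sup>2\<close>
  for \<open>x = p + w\<close>. Call this number \<open>D\<close>. The vector
  \<open>w + (r |w|\<^sup>2 - 1 / r) / 2 u\<close> equals \<open>D / 2\<close> times \<open>\<nu>(x) - c\<close>, so the open solid cone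
  over a subset \<open>A\<close> of the subsphere without \<open>N\<close> consists of the points
  \<open>c + a (w + (r |w|\<^sup>2 - 1 / r) / 2 u)\<close> with \<open>\<nu>(p + w) \<in> A\<close> and \<open>0 < a < 2 / D\<close>.
  Area is \<open>k / r\<close> times the volume of the cone, and this volume is computed in the coordinates
  \<open>(w, a)\<close>.

  Determinants in dimension \<open>k\<close> are avoided by two elementary steps, which form the lemma
  \<open>nn_integral_cone_chart\<close>. Write a point of \<open>\<tau>\<close> as \<open>c + z + s u\<close> with \<open>z \<in> V\<close>. For fixed
  \<open>z\<close>, the substitution \<open>s = (r |z|\<^sup>2 / a - a / r) / 2\<close> in one variable replaces \<open>s\<close> by
  \<open>a > 0\<close>. For fixed \<open>a\<close>, the scaling \<open>z = a w\<close> contributes the factor \<open>a^m\<close>. The total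
  Jacobian is \<open>a^m r D / 2\<close>, its integral over \<open>0 < a < 2 / D\<close> is \<open>(r / k) (2 / D)^m\<close>, and
  the factor \<open>k / r\<close> cancels.

  These computations need frames adapted to \<open>u\<close> and \<open>V\<close>. They are available because the measure
  of a plane does not depend on the frame, \<open>plane_lborel_frame\<close>. The passage from Borel measures
  to completed ones uses that \<open>\<nu>\<close> has a Borel measurable left inverse, so that the completions are
  isomorphic and integrability transfers in both directions, \<open>completion_isomorphism\<close>.
\<close>

section \<open>Frame independence of Lebesgue measure on planes\<close>

lemma nn_integral_PiM_affine:
  fixes c :: real and a :: "'i \<Rightarrow> real"
  assumes "finite I" "c \<noteq> 0" "f \<in> borel_measurable (\<Pi>\<^sub>M i\<in>I. (lborel :: real measure))"
  shows "(\<integral>\<^sup>+x. f x \<partial>(\<Pi>\<^sub>M i\<in>I. lborel))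
    = ennreal (\<bar>c\<bar> ^ card I) * (\<integral>\<^sup>+x. f (\<lambda>i\<in>I. a i + c * x i) \<partial>(\<Pi>\<^sub>M i\<in>I. lborel))"
  using assms(1,3)
proof (induction I arbitrary: f rule: finite_induct)
  case empty
  interpret product_sigma_finite "\<lambda>_::'i. lborel :: real measure" ..
  show ?case by (simp add: restrict_def PiM_empty nn_integral_count_space_finite)
next
  case (insert i I)
  interpret product_sigma_finite "\<lambda>_::'i. lborel :: real measure" ..
  interpret I: finite_product_sigma_finite "\<lambda>_::'i. lborel :: real measure" I
    by standard (rule insert.hyps)
  note [measurable] = insert.prems
  note [simp] = insert.hyps
  have upd: "(\<lambda>j\<in>I. a j + c * x j)(i := a i + c * y)
      = (\<lambda>j\<in>insert i I. a j + c * (x(i := y)) j)" for x y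
    by (auto simp: fun_eq_iff)
  have "(\<integral>\<^sup>+x. f x \<partial>(\<Pi>\<^sub>M i\<in>insert i I. lborel))
      = (\<integral>\<^sup>+x. (\<integral>\<^sup>+y. f (x(i := y)) \<partial>lborel) \<partial>(\<Pi>\<^sub>M i\<in>I. lborel))"
    by (rule product_nn_integral_insert) auto
  also have "\<dots> = (\<integral>\<^sup>+x. ennreal \<bar>c\<bar> * (\<integral>\<^sup>+y. f (x(i := a i + c * y)) \<partial>lborel) \<partial>(\<Pi>\<^sub>M i\<in>I. lborel))"
    by (intro nn_integral_cong nn_integral_real_affine) (use assms(2) in measurable)
  also have "\<dots> = ennreal \<bar>c\<bar> * (\<integral>\<^sup>+x. (\<integral>\<^sup>+y. f (x(i := a i + c * y)) \<partial>lborel) \<partial>(\<Pi>\<^sub>M i\<in>I. lborel))"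
    by (rule nn_integral_cmult) measurable
  also have "(\<integral>\<^sup>+x. (\<integral>\<^sup>+y. f (x(i := a i + c * y)) \<partial>lborel) \<partial>(\<Pi>\<^sub>M i\<in>I. lborel))
      = ennreal (\<bar>c\<bar> ^ card I) * (\<integral>\<^sup>+x. (\<integral>\<^sup>+y. f (\<lambda>j\<in>insert i I. a j + c * (x(i := y)) j) \<partial>lborel) \<partial>(\<Pi>\<^sub>M i\<in>I. lborel))"
    by (subst insert.IH) (measurable, simp only: upd)
  also have "(\<integral>\<^sup>+x. (\<integral>\<^sup>+y. f (\<lambda>j\<in>insert i I. a j + c * (x(i := y)) j) \<partial>lborel) \<partial>(\<Pi>\<^sub>M i\<in>I. lborel))
      = (\<integral>\<^sup>+x. f (\<lambda>j\<in>insert i I. a j + c * x j) \<partial>(\<Pi>\<^sub>M i\<in>insert i I. lborel))"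
    by (rule product_nn_integral_insert[symmetric]) (auto, measurable)
  finally show ?case
    unfolding card_insert_disjoint[OF insert.hyps] power_Suc
    by (simp only: ennreal_mult abs_ge_zero zero_le_power mult.assoc)
qed

definition orthonormal_family :: "'i set \<Rightarrow> ('i \<Rightarrow> 'a::euclidean_space) \<Rightarrow> bool" where
  "orthonormal_family I e \<longleftrightarrow> finite I \<and> (\<forall>i\<in>I. \<forall>j\<in>I. e i \<bullet> e j = (if i = j then 1 else 0))"

text \<open>
  The index type of a frame is arbitrary, so that frames in different ambient spaces can share one
  index set and their coordinates can be compared without reindexing.
\<close>

definition frame_map :: "'i set \<Rightarrow> ('i \<Rightarrow> 'a::euclidean_space) \<Rightarrow> ('i \<Rightarrow> real) \<Rightarrow> 'a" where
  "frame_map I e t = (\<Sum>i\<in>I. t i *\<^sub>R e i)"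

lemma frame_map_measurable [measurable]:
  "frame_map I e \<in> (\<Pi>\<^sub>M i\<in>I. (lborel :: real measure)) \<rightarrow>\<^sub>M borel"
  unfolding frame_map_def by measurable

lemma frame_map_affine:
  "frame_map I e (\<lambda>i\<in>I. a i + c * t i) = frame_map I e a + c *\<^sub>R frame_map I e t"
  by (simp add: frame_map_def scaleR_add_left sum.distrib scaleR_sum_right)

lemma frame_map_in_span: "frame_map I e t \<in> span (e ` I)"
  unfolding frame_map_def by (intro span_sum span_scale span_base) auto

lemma frame_map_inner:
  assumes "orthonormal_family I e"
  shows "frame_map I e s \<bullet> frame_map I e t = (\<Sum>i\<in>I. s i * t i)"
proof -
  have "frame_map I e s \<bullet> frame_map I e t
      = (\<Sum>i\<in>I. \<Sum>j\<in>I. if i = j then s i * t j else 0)"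
    unfolding frame_map_def inner_sum_left inner_sum_right
    using assms by (intro sum.cong) (auto simp: orthonormal_family_def)
  then show ?thesis
    using assms by (simp add: orthonormal_family_def)
qed

lemma norm_frame_map:
  assumes "orthonormal_family I e"
  shows "(norm (frame_map I e t))\<^sup>2 = (\<Sum>i\<in>I. (t i)\<^sup>2)"
  unfolding power2_norm_eq_inner frame_map_inner[OF assms] by (simp add: power2_eq_square)

lemma frame_map_coords:
  assumes "orthonormal_family I e" "v \<in> span (e ` I)"
  shows "frame_map I e (\<lambda>i. v \<bullet> e i) = v"
  using assms(2)
proof (induction rule: span_induct_alt)
  case base
  show ?case by (simp add: frame_map_def)
next
  case (step c x y)
  then obtain j where j: "j \<in> I" "x = e j" by auto
  have "frame_map I e (\<lambda>i. e j \<bullet> e i) = (\<Sum>i\<in>I. if i = j then e i else 0)"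
    unfolding frame_map_def using j(1) assms(1)
    by (intro sum.cong) (auto simp: orthonormal_family_def)
  also have "\<dots> = e j" using j(1) assms(1) by (simp add: orthonormal_family_def)
  finally have "frame_map I e (\<lambda>i. e j \<bullet> e i) = e j" .
  with step.IH show ?case
    by (simp add: j frame_map_def inner_add_left scaleR_add_left sum.distrib
        flip: scaleR_scaleR scaleR_sum_right)
qed

lemma orthonormal_family_card:
  assumes "orthonormal_family I e"
  shows "card I = dim (e ` I)"
proof -
  have fin: "finite I" and on: "\<And>i j. i \<in> I \<Longrightarrow> j \<in> I \<Longrightarrow> e i \<bullet> e j = (if i = j then 1 else 0)"
    using assms by (auto simp: orthonormal_family_def)
  have inj: "inj_on e I" using on by (metis inj_onI zero_neq_one)
  have "pairwise orthogonal (e ` I)"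
    unfolding pairwise_def orthogonal_def using on by auto
  moreover have "0 \<notin> e ` I" using on by (metis imageE inner_zero_left zero_neq_one)
  ultimately have "independent (e ` I)"
    by (rule pairwise_orthogonal_independent)
  then have "dim (e ` I) = card (e ` I)" by (rule dim_eq_card_independent)
  with inj show ?thesis by (simp add: card_image)
qed

text \<open>
  The density of the \<open>d\<close>-dimensional standard normal distribution. It has total mass \<open>1\<close>
  in every orthonormal frame with \<open>d\<close> elements, because it depends on the norm alone and is a
  product in the coordinates of the frame.
\<close>

definition gauss_weight :: "nat \<Rightarrow> 'a::euclidean_space \<Rightarrow> ennreal" where
  "gauss_weight d x = ennreal ((1 / sqrt (2 * pi)) ^ d * exp (- (norm x)\<^sup>2 / 2))"

lemma gauss_weight_measurable [measurable]: "gauss_weight d \<in> borel_measurable borel"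
  unfolding gauss_weight_def by measurable

lemma nn_integral_gauss_weight:
  assumes "orthonormal_family I e"
  shows "(\<integral>\<^sup>+t. gauss_weight (card I) (frame_map I e t) \<partial>(\<Pi>\<^sub>M i\<in>I. lborel)) = 1"
proof -
  interpret product_sigma_finite "\<lambda>_::'a. lborel :: real measure" ..
  have fin: "finite I" using assms by (simp add: orthonormal_family_def)
  interpret P: prob_space "density lborel (\<lambda>x. ennreal (std_normal_density x))"
    using prob_space_normal_density[of 1 0] by simp
  have one: "(\<integral>\<^sup>+x. ennreal (std_normal_density x) \<partial>lborel) = 1"
    using P.emeasure_space_1 by (simp add: emeasure_density)
  have "gauss_weight (card I) (frame_map I e t) = (\<Prod>i\<in>I. ennreal (std_normal_density (t i)))" for t
    using fin by (simp add: gauss_weight_def norm_frame_map[OF assms] std_normal_density_def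
        prod_ennreal prod.distrib power_divide prod_dividef sum_negf sum_divide_distrib
        flip: exp_sum)
  then show ?thesis
    using product_nn_integral_prod[OF fin, of "\<lambda>_ x. ennreal (std_normal_density x)"] one by simp
qed

text \<open>
  Both integrals are invariant under translation along the common span, and translation-invariant
  measures agree up to a constant: with an even weight \<open>G\<close>, exchange the order of integration in
  the double integral of \<open>h (p + x) G y\<close> and shear the variables, \<open>x\<close> by \<open>y\<close>, then \<open>y\<close> by
  \<open>- x\<close>, then \<open>x\<close> by \<open>y\<close> again. This moves \<open>h\<close> to the second frame and \<open>G\<close> to the first.
  With the Gaussian weight the constant is \<open>1\<close>.
\<close>

lemma nn_integral_frame_unique:
  fixes e :: "'i \<Rightarrow> 'a::euclidean_space" and e' :: "'j \<Rightarrow> 'a"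
  assumes e: "orthonormal_family I e" and e': "orthonormal_family J e'"
    and span: "span (e ` I) = span (e' ` J)"
    and pq: "p - q \<in> span (e ` I)"
    and [measurable]: "h \<in> borel_measurable borel"
  shows "(\<integral>\<^sup>+t. h (p + frame_map I e t) \<partial>(\<Pi>\<^sub>M i\<in>I. lborel))
    = (\<integral>\<^sup>+t. h (q + frame_map J e' t) \<partial>(\<Pi>\<^sub>M i\<in>J. lborel))"
proof -
  interpret P1: product_sigma_finite "\<lambda>_::'i. lborel :: real measure" ..
  interpret P2: product_sigma_finite "\<lambda>_::'j. lborel :: real measure" ..
  have fin: "finite I" "finite J" using e e' by (simp_all add: orthonormal_family_def)
  define M where "M = (\<Pi>\<^sub>M i\<in>I. (lborel :: real measure))"
  define N where "N = (\<Pi>\<^sub>M i\<in>J. (lborel :: real measure))"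
  interpret M: sigma_finite_measure M unfolding M_def by (rule P1.sigma_finite[OF fin(1)])
  interpret N: sigma_finite_measure N unfolding N_def by (rule P2.sigma_finite[OF fin(2)])
  interpret MN: pair_sigma_finite M N ..
  have [measurable]: "frame_map I e \<in> M \<rightarrow>\<^sub>M borel" "frame_map J e' \<in> N \<rightarrow>\<^sub>M borel"
    unfolding M_def N_def by measurable
  let ?L = "frame_map I e" and ?L' = "frame_map J e'"
  have d: "card I = card J"
    using orthonormal_family_card[OF e] orthonormal_family_card[OF e'] span by (metis dim_span)
  define G :: "'a \<Rightarrow> ennreal" where "G = gauss_weight (card I)"
  have [measurable]: "G \<in> borel_measurable borel" by (simp add: G_def)
  have G1: "(\<integral>\<^sup>+t. G (?L t) \<partial>M) = 1" "(\<integral>\<^sup>+t. G (?L' t) \<partial>N) = 1"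
    using nn_integral_gauss_weight[OF e] nn_integral_gauss_weight[OF e'] d
    by (simp_all add: G_def M_def N_def)
  have G_even: "G (- x) = G x" for x by (simp add: G_def gauss_weight_def)
  have transM: "(\<integral>\<^sup>+t. H (?L t) \<partial>M) = (\<integral>\<^sup>+t. H (v + ?L t) \<partial>M)"
    if [measurable]: "H \<in> borel_measurable borel" and v: "v \<in> span (e ` I)" for H :: "'a \<Rightarrow> ennreal" and v
    using nn_integral_PiM_affine[OF fin(1), of 1 "\<lambda>t. H (?L t)" "\<lambda>i. v \<bullet> e i"]
      frame_map_coords[OF e v] frame_map_affine[of I e "\<lambda>i. v \<bullet> e i" 1]
    by (simp add: M_def)
  have transN: "(\<integral>\<^sup>+t. H (?L' t) \<partial>N) = (\<integral>\<^sup>+t. H (v + ?L' t) \<partial>N)"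
    if [measurable]: "H \<in> borel_measurable borel" and v: "v \<in> span (e' ` J)" for H :: "'a \<Rightarrow> ennreal" and v
    using nn_integral_PiM_affine[OF fin(2), of 1 "\<lambda>t. H (?L' t)" "\<lambda>i. v \<bullet> e' i"]
      frame_map_coords[OF e' v] frame_map_affine[of J e' "\<lambda>i. v \<bullet> e' i" 1]
    by (simp add: N_def)
  have "(\<integral>\<^sup>+t. h (p + ?L t) \<partial>M) = (\<integral>\<^sup>+s. (\<integral>\<^sup>+t. h (p + ?L t) \<partial>M) * G (?L' s) \<partial>N)"
    by (simp add: nn_integral_cmult G1)
  also have "\<dots> = (\<integral>\<^sup>+s. (\<integral>\<^sup>+t. h (q + ?L' s + ?L t) * G (?L' s) \<partial>M) \<partial>N)"
  proof (rule nn_integral_cong)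
    fix s
    have "q - p + ?L' s \<in> span (e ` I)"
      using pq frame_map_in_span[of J e' s] span_neg[OF pq] unfolding span
      by (intro span_add) auto
    from transM[of "\<lambda>x. h (p + x)", OF _ this]
    show "(\<integral>\<^sup>+t. h (p + ?L t) \<partial>M) * G (?L' s) = (\<integral>\<^sup>+t. h (q + ?L' s + ?L t) * G (?L' s) \<partial>M)"
      by (simp add: nn_integral_multc add_ac)
  qed
  also have "\<dots> = (\<integral>\<^sup>+t. (\<integral>\<^sup>+s. h (q + ?L' s + ?L t) * G (?L' s) \<partial>N) \<partial>M)"
    by (rule MN.Fubini') measurable
  also have "\<dots> = (\<integral>\<^sup>+t. (\<integral>\<^sup>+s. h (q + ?L' s) * G (?L' s - ?L t) \<partial>N) \<partial>M)"
  proof (rule nn_integral_cong)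
    fix t
    have "- ?L t \<in> span (e' ` J)"
      using frame_map_in_span[of I e t] span_neg unfolding span by blast
    from transN[of "\<lambda>x. h (q + x + ?L t) * G x", OF _ this]
    show "(\<integral>\<^sup>+s. h (q + ?L' s + ?L t) * G (?L' s) \<partial>N) = (\<integral>\<^sup>+s. h (q + ?L' s) * G (?L' s - ?L t) \<partial>N)"
      by (simp add: algebra_simps)
  qed
  also have "\<dots> = (\<integral>\<^sup>+s. (\<integral>\<^sup>+t. h (q + ?L' s) * G (?L' s - ?L t) \<partial>M) \<partial>N)"
    by (rule MN.Fubini'[symmetric]) measurable
  also have "\<dots> = (\<integral>\<^sup>+s. h (q + ?L' s) \<partial>N)"
  proof (rule nn_integral_cong)
    fix s
    have "?L' s \<in> span (e ` I)" using frame_map_in_span[of J e' s] unfolding span .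
    from transM[of "\<lambda>x. G (?L' s - x)", OF _ this]
    have "(\<integral>\<^sup>+t. G (?L' s - ?L t) \<partial>M) = 1" using G1(1) by (simp add: G_even)
    then show "(\<integral>\<^sup>+t. h (q + ?L' s) * G (?L' s - ?L t) \<partial>M) = h (q + ?L' s)"
      by (simp add: nn_integral_cmult)
  qed
  finally show ?thesis unfolding M_def N_def .
qed

text \<open>
  The definition of \<open>plane_lborel\<close> chooses some frame. This lemma allows any base point and any
  orthonormal family in its place.
\<close>

lemma plane_lborel_frame:
  fixes e :: "'i \<Rightarrow> 'a::euclidean_space"
  assumes e: "orthonormal_family I e" and z: "\<zeta> = (\<lambda>v. p + v) ` span (e ` I)"
  shows "plane_lborel \<zeta> = distr (\<Pi>\<^sub>M i\<in>I. lborel) borel (\<lambda>t. p + frame_map I e t)"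
proof -
  have "affine ((\<lambda>v. p + v) ` span (e ` I))"
    by (metis affine_translation subspace_imp_affine subspace_span)
  moreover have "\<zeta> \<noteq> {}" using span_zero[of "e ` I"] unfolding z by blast
  ultimately have "\<exists>pB. (case pB of (p, B) \<Rightarrow> plane_frame \<zeta> p B)"
    using plane_frame_exists[of \<zeta>] z by auto
  from someI_ex[OF this] obtain q B where
    qB: "(SOME (p, B). plane_frame \<zeta> p B) = (q, B)" and fr: "plane_frame \<zeta> q B"
    by (metis (mono_tags, lifting) case_prod_conv surj_pair)
  have B: "pairwise orthogonal B" "\<And>b. b \<in> B \<Longrightarrow> norm b = 1" "\<zeta> = (\<lambda>v. q + v) ` span B"
    using fr by (auto simp: plane_frame_def)
  have "finite B"
    using B(1,2) pairwise_orthogonal_imp_finite by blast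
  then have on: "orthonormal_family B id"
    using B(1,2) by (auto simp: orthonormal_family_def pairwise_def orthogonal_def dot_square_norm)
  have "q \<in> \<zeta>" "p \<in> \<zeta>"
    using span_zero[of B] span_zero[of "e ` I"] B(3) z by (force)+
  have pq: "p - q \<in> span B"
    using \<open>p \<in> \<zeta>\<close> unfolding B(3) by auto
  have qp: "q - p \<in> span (e ` I)"
    using \<open>q \<in> \<zeta>\<close> unfolding z by auto
  have "span (e ` I) = span B"
  proof (intro equalityI subsetI)
    fix v assume "v \<in> span (e ` I)"
    then have "p + v \<in> \<zeta>" using z by auto
    then have "p + v - q \<in> span B" using B(3) by auto
    from span_diff[OF this pq] show "v \<in> span B" by simp
  next
    fix v assume "v \<in> span B"
    then have "q + v \<in> \<zeta>" using B(3) by auto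
    then have "q + v - p \<in> span (e ` I)" using z by auto
    from span_diff[OF this qp] show "v \<in> span (e ` I)" by simp
  qed
  then have sp: "span (id ` B) = span (e ` I)" by simp
  have "distr (\<Pi>\<^sub>M b\<in>B. lborel) borel (\<lambda>t. q + frame_map B id t)
      = distr (\<Pi>\<^sub>M i\<in>I. lborel) borel (\<lambda>t. p + frame_map I e t)" (is "?M = ?N")
  proof (rule measure_eqI)
    fix A assume "A \<in> sets ?M"
    then have [measurable]: "A \<in> sets borel" by simp
    have "emeasure ?M A = (\<integral>\<^sup>+x. indicator A x \<partial>?M)" by simp
    also have "\<dots> = (\<integral>\<^sup>+t. indicator A (q + frame_map B id t) \<partial>(\<Pi>\<^sub>M b\<in>B. lborel))"
      by (rule nn_integral_distr) measurable
    also have "\<dots> = (\<integral>\<^sup>+t. indicator A (p + frame_map I e t) \<partial>(\<Pi>\<^sub>M i\<in>I. lborel))"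
      by (rule nn_integral_frame_unique[OF on e sp]) (use pq qp sp in \<open>auto\<close>)
    also have "\<dots> = (\<integral>\<^sup>+x. indicator A x \<partial>?N)"
      by (rule nn_integral_distr[symmetric]) measurable
    also have "\<dots> = emeasure ?N A" by simp
    finally show "emeasure ?M A = emeasure ?N A" .
  qed simp
  then show ?thesis
    by (simp add: plane_lborel_def qB frame_map_def)
qed

section \<open>Transfer of integrals between completed measures\<close>

lemma measurable_completion_cong_AE:
  assumes f: "f \<in> completion M \<rightarrow>\<^sub>M N" and ae: "AE x in completion M. f x = g x"
    and g: "\<And>x. x \<in> space M \<Longrightarrow> g x \<in> space N"
  shows "g \<in> completion M \<rightarrow>\<^sub>M N"
proof (rule measurableI)
  fix A assume A: "A \<in> sets N"
  show "g -` A \<inter> space (completion M) \<in> sets (completion M)"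
  proof (rule completion.in_sets_AE)
    show "f -` A \<inter> space (completion M) \<in> sets (completion M)"
      using f A by (rule measurable_sets)
    show "AE x in completion M. x \<in> f -` A \<inter> space (completion M) \<longleftrightarrow> x \<in> g -` A \<inter> space (completion M)"
      using ae by eventually_elim auto
  qed auto
qed (use g in auto)

text \<open>
  The map \<open>T\<close> alone would give only that \<open>F \<circ> T\<close> is measurable for the completion if \<open>F\<close> is.
  The converse comes from the inverse \<open>S\<close>: it is measurable between the completions too, because
  its image of the measure \<open>M\<close> is \<open>N\<close>, and \<open>F\<close> agrees almost everywhere with \<open>(F \<circ> T) \<circ> S\<close>.
\<close>

lemma completion_isomorphism:
  fixes F :: "'y \<Rightarrow> 'b::{banach, second_countable_topology}"
  assumes T: "T \<in> N \<rightarrow>\<^sub>M M" and S: "S \<in> M \<rightarrow>\<^sub>M N"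
    and M: "distr N M T = M"
    and ST: "\<And>x. x \<in> space N \<Longrightarrow> S (T x) = x"
    and TS: "AE y in M. T (S y) = y"
  shows "integrable (completion M) F \<longleftrightarrow> integrable (completion N) (\<lambda>x. F (T x))" (is ?int)
    and "integral\<^sup>L (completion M) F = integral\<^sup>L (completion N) (\<lambda>x. F (T x))" (is ?eq)
proof -
  have "distr M N S = distr (distr N M T) N S" by (simp add: M)
  also have "\<dots> = distr N N (S \<circ> T)" by (rule distr_distr[OF S T])
  also have "\<dots> = distr N N (\<lambda>x. x)" by (rule distr_cong) (simp_all add: ST)
  finally have N: "distr M N S = N" by simp
  have dT: "distr (completion N) M T = M" using distr_completion[OF T] M by simp
  have dS: "distr (completion M) N S = N" using distr_completion[OF S] N by simp
  have cT: "T \<in> completion N \<rightarrow>\<^sub>M completion M"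
    by (rule completion.measurable_completion2) (simp_all add: measurable_completion[OF T] dT)
  have cS: "S \<in> completion M \<rightarrow>\<^sub>M completion N"
    by (rule completion.measurable_completion2) (simp_all add: measurable_completion[OF S] dS)
  have cM: "completion M = distr (completion N) (completion M) T"
    using completion.completion_distr_eq[OF measurable_completion[OF T]] dT by simp
  have meas: "F \<in> borel_measurable (completion M)"
    if "(\<lambda>x. F (T x)) \<in> borel_measurable (completion N)"
  proof (rule measurable_completion_cong_AE)
    show "(\<lambda>y. F (T (S y))) \<in> borel_measurable (completion M)"
      using measurable_compose[OF cS that] .
    show "AE y in completion M. F (T (S y)) = F y"
      using AE_completion[OF TS] by eventually_elim simp
  qed simp
  show i: ?int
  proof
    assume "integrable (completion M) F"
    then show "integrable (completion N) (\<lambda>x. F (T x))"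
      by (subst (asm) cM) (rule integrable_distr[OF cT])
  next
    assume "integrable (completion N) (\<lambda>x. F (T x))"
    with meas show "integrable (completion M) F"
      by (subst cM) (simp add: integrable_distr_eq[OF cT] borel_measurable_integrable)
  qed
  show ?eq
  proof (cases "integrable (completion M) F")
    case True
    then show ?thesis
      by (subst cM) (rule integral_distr[OF cT borel_measurable_integrable])
  next
    case False
    with i show ?thesis by (simp add: not_integrable_integral_eq)
  qed
qed

text \<open>
  A positive density neither creates nor destroys null sets, so forming the density commutes with
  completion. Positivity also makes \<open>H\<close> measurable whenever \<open>W *\<^sub>R H\<close> is.
\<close>

lemma completion_density_transfer:
  fixes H :: "'x \<Rightarrow> 'b::{banach, second_countable_topology}"
  assumes W [measurable]: "W \<in> borel_measurable M" and pos: "\<And>x. 0 < W x"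
  shows "integrable (completion (density M (\<lambda>x. ennreal (W x)))) H
      \<longleftrightarrow> integrable (completion M) (\<lambda>x. W x *\<^sub>R H x)" (is "integrable ?D H \<longleftrightarrow> ?R")
    and "integral\<^sup>L (completion (density M (\<lambda>x. ennreal (W x)))) H
      = integral\<^sup>L (completion M) (\<lambda>x. W x *\<^sub>R H x)"
proof -
  have D: "?D = density (completion M) (\<lambda>x. ennreal (W x))"
    by (rule completion_density_eq) (simp_all add: pos)
  have W': "W \<in> borel_measurable (completion M)" by (rule measurable_completion[OF W])
  have nn: "AE x in completion M. 0 \<le> W x" using pos less_imp_le by blast
  show iff: "integrable ?D H \<longleftrightarrow> ?R"
  proof
    assume i: "integrable ?D H"
    then have "H \<in> borel_measurable (completion M)"
      using borel_measurable_integrable[OF i] by (simp add: D)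
    from integrable_density[OF this W' nn] i show ?R by (simp add: D)
  next
    assume i: ?R
    have "(\<lambda>x. inverse (W x) *\<^sub>R (W x *\<^sub>R H x)) \<in> borel_measurable (completion M)"
      by (rule borel_measurable_scaleR[OF borel_measurable_inverse[OF W'] borel_measurable_integrable[OF i]])
    also have "(\<lambda>x. inverse (W x) *\<^sub>R (W x *\<^sub>R H x)) = H"
      using pos by (simp add: fun_eq_iff less_imp_neq[symmetric])
    finally have "H \<in> borel_measurable (completion M)" .
    from integrable_density[OF this W' nn] i show "integrable ?D H" by (simp add: D)
  qed
  show "integral\<^sup>L ?D H = integral\<^sup>L (completion M) (\<lambda>x. W x *\<^sub>R H x)"
  proof (cases "integrable ?D H")
    case True
    then have "H \<in> borel_measurable (completion M)"
      using borel_measurable_integrable[OF True] by (simp add: D)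
    from integral_density[OF this W' nn] show ?thesis by (simp add: D)
  next
    case False
    with iff show ?thesis by (simp add: not_integrable_integral_eq)
  qed
qed

section \<open>Volume in cone coordinates\<close>

text \<open>
  The function \<open>a \<mapsto> (b / a - q a) / 2\<close> is a decreasing bijection from the positive half-line
  to the real line. The substitution is made on compact intervals that exhaust the half-line, after
  the reflection \<open>s \<mapsto> - s\<close>, which makes the function increasing.
\<close>

lemma nn_integral_hyperbolic_substitution:
  fixes F :: "real \<Rightarrow> ennreal"
  assumes q: "0 < q" and b: "0 < b" and [measurable]: "F \<in> borel_measurable borel"
  shows "(\<integral>\<^sup>+s. F s \<partial>lborel)
    = (\<integral>\<^sup>+a. F ((b / a - q * a) / 2) * ennreal ((b / a\<^sup>2 + q) / 2) * indicator {0<..} a \<partial>lborel)"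
proof -
  define g where "g a = (q * a - b / a) / 2" for a
  define g' where "g' a = (b / a\<^sup>2 + q) / 2" for a
  define l where "l n = 1 / (real n + 2)" for n
  define h where "h n = real n + 2" for n
  have lh: "0 < l n" "l n < h n" for n
  proof -
    show "0 < l n" by (simp add: l_def)
    have "l n \<le> 1" by (simp add: l_def)
    then show "l n < h n" by (simp add: h_def)
  qed
  have mono: "l n \<le> l m" "h m \<le> h n" if "m \<le> n" for m n
    using that by (simp_all add: l_def h_def frac_le)
  have deriv: "(g has_real_derivative g' a) (at a)" if "0 < a" for a
    unfolding g_def g'_def using that
    by (auto intro!: derivative_eq_intros simp: field_simps power2_eq_square)
  have g_mono: "g x \<le> g y" if "0 < x" "x \<le> y" for x y
  proof -
    have "q * x \<le> q * y" "b / y \<le> b / x"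
      using that q b by (auto intro!: divide_left_mono)
    then show ?thesis by (simp add: g_def)
  qed
  have piece: "(\<integral>\<^sup>+s. F (- s) * indicator {g (l n)..g (h n)} s \<partial>lborel)
      = (\<integral>\<^sup>+a. F (- g a) * g' a * indicator {l n..h n} a \<partial>lborel)" for n
  proof (rule nn_integral_substitution_aux)
    show "continuous_on {l n..h n} g'"
      unfolding g'_def using lh[of n] by (intro continuous_intros) auto
    show "(g has_real_derivative g' x) (at x)" if "x \<in> {l n..h n}" for x
      using that lh(1)[of n] by (intro deriv) auto
    show "0 \<le> g' x" for x using q b by (simp add: g'_def)
  qed (use lh in auto)
  have "(\<lambda>n. \<integral>\<^sup>+s. F (- s) * indicator {g (l n)..g (h n)} s \<partial>lborel)
      \<longlonglongrightarrow> (\<integral>\<^sup>+s. F (- s) \<partial>lborel)"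
  proof (rule nn_integral_LIMSEQ)
    show "incseq (\<lambda>n s. F (- s) * indicator {g (l n)..g (h n)} s)"
    proof (intro monoI le_funI mult_left_mono)
      fix m n :: nat and s assume "m \<le> n"
      then have "g (l n) \<le> g (l m)" "g (h m) \<le> g (h n)"
        using mono[of m n] lh[of m] lh[of n] by (auto intro: g_mono)
      then show "indicator {g (l m)..g (h m)} s \<le> (indicator {g (l n)..g (h n)} s :: ennreal)"
        by (auto split: split_indicator)
    qed simp
    fix s
    have "filterlim (\<lambda>n. g (h n)) at_top sequentially" "filterlim (\<lambda>n. g (l n)) at_bot sequentially"
      unfolding g_def h_def l_def using q b by real_asymp+
    then have "\<forall>\<^sub>F n in sequentially. s \<le> g (h n)" "\<forall>\<^sub>F n in sequentially. g (l n) \<le> s"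
      by (auto simp: filterlim_at_top filterlim_at_bot)
    then have "\<forall>\<^sub>F n in sequentially. F (- s) * indicator {g (l n)..g (h n)} s = F (- s)"
      by eventually_elim simp
    then show "(\<lambda>n. F (- s) * indicator {g (l n)..g (h n)} s) \<longlonglongrightarrow> F (- s)"
      by (rule tendsto_eventually)
  qed simp
  moreover have "(\<lambda>n. \<integral>\<^sup>+a. F (- g a) * g' a * indicator {l n..h n} a \<partial>lborel)
      \<longlonglongrightarrow> (\<integral>\<^sup>+a. F (- g a) * g' a * indicator {0<..} a \<partial>lborel)"
  proof (rule nn_integral_LIMSEQ)
    show "incseq (\<lambda>n a. F (- g a) * ennreal (g' a) * indicator {l n..h n} a)"
    proof (intro monoI le_funI mult_left_mono)
      fix m n :: nat and a assume "m \<le> n"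
      then show "indicator {l m..h m} a \<le> (indicator {l n..h n} a :: ennreal)"
        using mono[of m n] by (auto split: split_indicator)
    qed simp
    show "(\<lambda>a. F (- g a) * ennreal (g' a) * indicator {l n..h n} a) \<in> borel_measurable lborel" for n
      unfolding g_def g'_def by measurable
    fix a :: real
    show "(\<lambda>n. F (- g a) * ennreal (g' a) * indicator {l n..h n} a)
        \<longlonglongrightarrow> F (- g a) * ennreal (g' a) * indicator {0<..} a"
    proof (cases "0 < a")
      case True
      have "filterlim h at_top sequentially" "(l \<longlongrightarrow> 0) sequentially"
        unfolding h_def l_def by real_asymp+
      then have "\<forall>\<^sub>F n in sequentially. a \<le> h n" "\<forall>\<^sub>F n in sequentially. l n < a"
        using True by (auto simp: filterlim_at_top order_tendsto_iff)
      then have "\<forall>\<^sub>F n in sequentially. F (- g a) * ennreal (g' a) * indicator {l n..h n} a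
          = F (- g a) * ennreal (g' a) * indicator {0<..} a"
        by eventually_elim (use True in simp)
      then show ?thesis by (rule tendsto_eventually)
    next
      case False
      then have "a \<notin> {l n..h n}" for n using lh(1)[of n] by auto
      then show ?thesis using False by simp
    qed
  qed
  ultimately have "(\<integral>\<^sup>+s. F (- s) \<partial>lborel) = (\<integral>\<^sup>+a. F (- g a) * g' a * indicator {0<..} a \<partial>lborel)"
    unfolding piece by (rule LIMSEQ_unique)
  moreover have "(\<integral>\<^sup>+s. F s \<partial>lborel) = (\<integral>\<^sup>+s. F (- s) \<partial>lborel)"
    using nn_integral_real_affine[of F "-1" 0] by simp
  moreover have "- g a = (b / a - q * a) / 2" for a by (simp add: g_def field_simps)
  ultimately show ?thesis by (simp add: g'_def)
qed

text \<open>
  Change of variables for \<open>(w, a) \<mapsto> (a w, a (r |w|\<^sup>2 - 1 / r) / 2)\<close>. In terms of \<open>z = a w\<close>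
  the last coordinate is \<open>(r |z|\<^sup>2 / a - a / r) / 2\<close>, so the map is the composition of a
  substitution in one variable, for fixed \<open>z \<noteq> 0\<close>, and a scaling, for fixed \<open>a\<close>.
\<close>

lemma nn_integral_cone_chart:
  fixes e :: "'i \<Rightarrow> 'a::euclidean_space" and F :: "'a \<times> real \<Rightarrow> ennreal"
  assumes on: "orthonormal_family I e" and ne: "I \<noteq> {}" and r: "0 < r"
    and [measurable]: "F \<in> borel_measurable borel"
  defines "L \<equiv> frame_map I e"
  shows "(\<integral>\<^sup>+t. (\<integral>\<^sup>+s. F (L t, s) \<partial>lborel) \<partial>(\<Pi>\<^sub>M i\<in>I. lborel))
    = (\<integral>\<^sup>+t. (\<integral>\<^sup>+a. F (a *\<^sub>R L t, a * ((r * (norm (L t))\<^sup>2 - 1 / r) / 2))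
          * ennreal (a ^ card I * ((r * (norm (L t))\<^sup>2 + 1 / r) / 2)) * indicator {0<..} a \<partial>lborel)
        \<partial>(\<Pi>\<^sub>M i\<in>I. lborel))"
proof -
  interpret P: product_sigma_finite "\<lambda>_::'i. lborel :: real measure" ..
  have fin: "finite I" using on by (simp add: orthonormal_family_def)
  define P where "P = (\<Pi>\<^sub>M i\<in>I. (lborel :: real measure))"
  interpret P: sigma_finite_measure P unfolding P_def by (rule P.sigma_finite[OF fin])
  interpret PP: pair_sigma_finite P "lborel :: real measure" ..
  have [measurable]: "L \<in> P \<rightarrow>\<^sub>M borel" unfolding P_def L_def by measurable
  have [measurable]: "F \<in> borel_measurable (borel \<Otimes>\<^sub>M borel)"
    by (simp add: borel_prod)
  \<comment> \<open>The substitution degenerates at the origin, a null set since the dimension is positive.\<close>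
  have nz: "AE t in P. L t \<noteq> 0"
  proof (rule AE_I')
    show "(\<Pi>\<^sub>E i\<in>I. {0}) \<in> null_sets P"
    proof (rule null_setsI)
      show "emeasure P (\<Pi>\<^sub>E i\<in>I. {0}) = 0"
        unfolding P_def using P.emeasure_PiM[OF fin, of "\<lambda>_. {0}"] fin ne
        by (simp add: power_0_left card_gt_0_iff)
      show "(\<Pi>\<^sub>E i\<in>I. {0}) \<in> sets P"
        unfolding P_def by (intro sets_PiM_I_finite fin) auto
    qed
    show "{t \<in> space P. \<not> L t \<noteq> 0} \<subseteq> (\<Pi>\<^sub>E i\<in>I. {0})"
    proof
      fix t assume "t \<in> {t \<in> space P. \<not> L t \<noteq> 0}"
      then have t: "t \<in> space P" "(\<Sum>i\<in>I. (t i)\<^sup>2) = 0"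
        using norm_frame_map[OF on, of t] by (auto simp: L_def)
      then show "t \<in> (\<Pi>\<^sub>E i\<in>I. {0})"
        using fin by (auto simp: P_def space_PiM sum_nonneg_eq_0_iff PiE_iff extensional_def fun_eq_iff)
    qed
  qed
  define K where "K t a = F (L t, (r * (norm (L t))\<^sup>2 / a - 1 / r * a) / 2)
      * ennreal ((r * (norm (L t))\<^sup>2 / a\<^sup>2 + 1 / r) / 2) * indicator {0<..} a" for t a
  have [measurable]: "case_prod K \<in> borel_measurable (P \<Otimes>\<^sub>M lborel)"
    unfolding K_def by measurable
  define K' where "K' t a = F (a *\<^sub>R L t, a * ((r * (norm (L t))\<^sup>2 - 1 / r) / 2))
      * ennreal (a ^ card I * ((r * (norm (L t))\<^sup>2 + 1 / r) / 2)) * indicator {0<..} a" for t a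
  have [measurable]: "case_prod K' \<in> borel_measurable (P \<Otimes>\<^sub>M lborel)"
    unfolding K'_def by measurable
  have "(\<integral>\<^sup>+t. (\<integral>\<^sup>+s. F (L t, s) \<partial>lborel) \<partial>P) = (\<integral>\<^sup>+t. (\<integral>\<^sup>+a. K t a \<partial>lborel) \<partial>P)"
  proof (rule nn_integral_cong_AE, use nz in eventually_elim)
    fix t assume "L t \<noteq> 0"
    then show "(\<integral>\<^sup>+s. F (L t, s) \<partial>lborel) = (\<integral>\<^sup>+a. K t a \<partial>lborel)"
      unfolding K_def using r by (intro nn_integral_hyperbolic_substitution) auto
  qed
  also have "\<dots> = (\<integral>\<^sup>+a. (\<integral>\<^sup>+t. K t a \<partial>P) \<partial>lborel)"
    by (rule PP.Fubini'[symmetric]) measurable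
  also have "\<dots> = (\<integral>\<^sup>+a. (\<integral>\<^sup>+t. K' t a \<partial>P) \<partial>lborel)"
  proof (rule nn_integral_cong)
    fix a :: real
    show "(\<integral>\<^sup>+t. K t a \<partial>P) = (\<integral>\<^sup>+t. K' t a \<partial>P)"
    proof (cases "0 < a")
      case True
      have La: "L (\<lambda>i\<in>I. 0 + a * t i) = a *\<^sub>R L t" for t
        using frame_map_affine[of I e "\<lambda>_. 0" a t] by (simp add: L_def frame_map_def)
      have Kmeas: "(\<lambda>t. K t a) \<in> borel_measurable (\<Pi>\<^sub>M i\<in>I. lborel)"
        unfolding P_def[symmetric] by measurable
      have "(\<integral>\<^sup>+t. K t a \<partial>P)
          = ennreal (\<bar>a\<bar> ^ card I) * (\<integral>\<^sup>+t. K (\<lambda>i\<in>I. 0 + a * t i) a \<partial>P)"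
        unfolding P_def using True by (intro nn_integral_PiM_affine fin Kmeas) auto
      also have "\<dots> = (\<integral>\<^sup>+t. ennreal (\<bar>a\<bar> ^ card I) * K (\<lambda>i\<in>I. 0 + a * t i) a \<partial>P)"
        unfolding K_def La by (rule nn_integral_cmult[symmetric]) measurable
      also have "\<dots> = (\<integral>\<^sup>+t. K' t a \<partial>P)"
      proof (rule nn_integral_cong)
        fix t
        have 1: "(r * (norm (a *\<^sub>R L t))\<^sup>2 / a - 1 / r * a) / 2 = a * ((r * (norm (L t))\<^sup>2 - 1 / r) / 2)"
          using True by (simp add: power_mult_distrib field_simps power2_eq_square)
        have 2: "(r * (norm (a *\<^sub>R L t))\<^sup>2 / a\<^sup>2 + 1 / r) / 2 = (r * (norm (L t))\<^sup>2 + 1 / r) / 2"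
          using True by (simp add: power_mult_distrib)
        have 3: "ennreal (a ^ card I * ((r * (norm (L t))\<^sup>2 + 1 / r) / 2))
            = ennreal (a ^ card I) * ennreal ((r * (norm (L t))\<^sup>2 + 1 / r) / 2)"
          using True r by (intro ennreal_mult) auto
        show "ennreal (\<bar>a\<bar> ^ card I) * K (\<lambda>i\<in>I. 0 + a * t i) a = K' t a"
          unfolding K_def K'_def La 1 2 3 using True by (simp add: mult_ac)
      qed
      finally show ?thesis .
    qed (simp add: K_def K'_def)
  qed
  also have "\<dots> = (\<integral>\<^sup>+t. (\<integral>\<^sup>+a. K' t a \<partial>lborel) \<partial>P)"
    by (rule PP.Fubini') measurable
  finally show ?thesis unfolding P_def K'_def .
qed

lemma nn_integral_power_Ioo:
  fixes c :: real
  assumes "0 < c"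
  shows "(\<integral>\<^sup>+a. ennreal (a ^ m) * indicator {0<..<c} a \<partial>lborel) = ennreal (c ^ Suc m / Suc m)"
proof -
  have "(\<integral>\<^sup>+a. ennreal (a ^ m) * indicator {0<..<c} a \<partial>lborel)
      = (\<integral>\<^sup>+a. ennreal (a ^ m) * indicator {0..c} a \<partial>lborel)"
    by (rule nn_integral_cong_AE, use AE_lborel_singleton[of 0] AE_lborel_singleton[of c] in eventually_elim)
      (auto split: split_indicator)
  also have "\<dots> = c ^ Suc m / Suc m - 0 ^ Suc m / Suc m"
  proof (rule nn_integral_FTC_Icc)
    show "((\<lambda>a. a ^ Suc m / Suc m) has_real_derivative x ^ m) (at x)" for x :: real
      using DERIV_power_Suc[of "\<lambda>a. a" 1 x UNIV m] by (auto intro!: derivative_eq_intros simp del: power_Suc)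
  qed (use assms in auto)
  finally show ?thesis by simp
qed

section \<open>Stereographic projection and its inverse\<close>

lemma inv_stereographic_eq_inversion:
  "inv_stereographic x = north_pole + (2 / ((norm x)\<^sup>2 + 1)) *\<^sub>R ((x, 0) - north_pole)"
proof -
  have "(norm x)\<^sup>2 + 1 \<noteq> 0" by (smt (verit) zero_le_power2)
  then show ?thesis
    by (simp add: inv_stereographic_def north_pole_def field_simps)
qed

lemma inv_stereographic_measurable [measurable]: "inv_stereographic \<in> borel_measurable borel"
proof (rule borel_measurable_continuous_onI)
  have "(norm x)\<^sup>2 + 1 \<noteq> 0" for x :: "real^'n" by (smt (verit) zero_le_power2)
  then show "continuous_on UNIV (inv_stereographic :: real^'n \<Rightarrow> _)"
    unfolding inv_stereographic_def by (intro continuous_intros) auto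
qed

text \<open>
  At the pole the value is \<open>0\<close>, by the convention for division by zero. This single point is
  harmless, since the image of \<open>inv_stereographic\<close> omits it.
\<close>

definition stereographic :: "(real^'n) \<times> real \<Rightarrow> real^'n" where
  "stereographic y = (1 / (1 - snd y)) *\<^sub>R fst y"

lemma stereographic_measurable [measurable]: "stereographic \<in> borel_measurable borel"
proof -
  have [measurable]: "fst \<in> borel_measurable (borel :: ((real^'n) \<times> real) measure)"
    "snd \<in> borel_measurable (borel :: ((real^'n) \<times> real) measure)"
    by (intro borel_measurable_continuous_onI continuous_intros)+
  show ?thesis unfolding stereographic_def by measurable
qed

lemma inv_stereographic_Pair:
  "inv_stereographic x = ((2 / ((norm x)\<^sup>2 + 1)) *\<^sub>R x, 1 - 2 / ((norm x)\<^sup>2 + 1))"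
  by (simp add: inv_stereographic_eq_inversion north_pole_def)

lemma stereographic_inv_stereographic [simp]: "stereographic (inv_stereographic x) = x"
proof -
  define D where "D = (norm x)\<^sup>2 + 1"
  have "D \<noteq> 0" unfolding D_def by (smt (verit) zero_le_power2)
  then show ?thesis by (simp add: inv_stereographic_Pair stereographic_def flip: D_def)
qed

lemma norm_inv_stereographic: "norm (inv_stereographic x) = 1"
proof -
  define D where "D = (norm x)\<^sup>2 + 1"
  have D: "D \<noteq> 0" "(norm x)\<^sup>2 = D - 1" unfolding D_def by (smt (verit) zero_le_power2)+
  have "(norm (inv_stereographic x))\<^sup>2 = (2 / D)\<^sup>2 * (norm x)\<^sup>2 + (1 - 2 / D)\<^sup>2"
    by (simp add: inv_stereographic_Pair norm_Pair power_mult_distrib power_divide flip: D_def)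
  also have "\<dots> = 1"
    using D(1) unfolding D(2) by (simp add: field_simps power2_eq_square)
  finally show ?thesis by (simp add: power2_eq_1_iff) (smt (verit) norm_ge_zero)
qed

text \<open>
  The point \<open>inv_stereographic x\<close> lies on the line through \<open>(x, 0)\<close> and the pole and differs
  from the pole.
\<close>

lemma inv_stereographic_in_plane_iff:
  assumes "affine \<tau>" "north_pole \<in> \<tau>"
  shows "inv_stereographic x \<in> \<tau> \<longleftrightarrow> (x, 0) \<in> \<tau>"
proof -
  define a where "a = 2 / ((norm x)\<^sup>2 + 1)"
  have a: "a \<noteq> 0" unfolding a_def by (smt (verit) zero_le_power2 divide_eq_0_iff)
  have eq: "inv_stereographic x = (1 - a) *\<^sub>R north_pole + a *\<^sub>R (x, 0)"
    unfolding inv_stereographic_eq_inversion a_def[symmetric] by (simp add: algebra_simps)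
  have "(1 / a) *\<^sub>R inv_stereographic x = (1 / a - 1) *\<^sub>R north_pole + (x, 0)"
    unfolding eq using a by (simp add: scaleR_add_right diff_divide_distrib)
  then have inv: "(x, 0) = (1 - 1 / a) *\<^sub>R north_pole + (1 / a) *\<^sub>R inv_stereographic x"
    by (simp add: scaleR_diff_left)
  show ?thesis
  proof
    assume "inv_stereographic x \<in> \<tau>"
    then show "(x, 0) \<in> \<tau>"
      unfolding inv by (intro mem_affine assms) auto
  next
    assume "(x, 0) \<in> \<tau>"
    then show "inv_stereographic x \<in> \<tau>"
      unfolding eq by (intro mem_affine assms) auto
  qed
qed

section \<open>Surface area as an image under the inverse stereographic projection\<close>

text \<open>
  The position of a slice relative to the pole: \<open>c\<close> and \<open>r\<close> are its centre and radius, \<open>u\<close>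
  points from the centre to the pole, and \<open>p\<close> is the foot of the perpendicular from the pole to
  the equatorial section. The distance \<open>1 / r\<close> is forced: inversion with centre \<open>N\<close> and power
  \<open>2\<close> sends the antipode of \<open>N\<close> in the slice, at distance \<open>2 r\<close> from \<open>N\<close>, to \<open>p\<close>.
\<close>

locale slice_coordinates =
  fixes u c :: "(real^'n) \<times> real" and r :: real and p :: "real^'n"
  assumes u: "norm u = 1" and r: "0 < r"
    and pole: "c + r *\<^sub>R u = north_pole"
    and foot: "(p, 0) = north_pole - (1 / r) *\<^sub>R u"
begin

text \<open>
  The indicator function of the open solid cone over \<open>A\<close>, translated so that its apex \<open>c\<close>
  becomes the origin. The value at the apex itself is arbitrary, as a single point has no volume.
\<close>

definition cone_indicator :: "((real^'n) \<times> real) set \<Rightarrow> (real^'n) \<times> real \<Rightarrow> ennreal" where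
  "cone_indicator A v = indicator A (c + (r / norm v) *\<^sub>R v) * indicator (ball 0 r) v"

lemma cone_indicator_measurable [measurable]:
  assumes [measurable]: "A \<in> sets borel"
  shows "cone_indicator A \<in> borel_measurable borel"
proof -
  have [measurable]: "Measurable.pred borel (\<lambda>v :: (real^'n) \<times> real. v \<in> ball 0 r)"
    unfolding mem_ball by measurable
  show ?thesis unfolding cone_indicator_def by measurable
qed

lemma inner_u_u: "u \<bullet> u = 1"
  using u by (simp add: norm_eq_1)

context
  fixes w :: "real^'n" and D :: real
  assumes orth: "(w, 0) \<bullet> u = 0"
  defines "D \<equiv> (norm w)\<^sup>2 + (1 / r)\<^sup>2"
begin

lemma D_pos: "0 < D"
  unfolding D_def using r by (intro add_nonneg_pos) auto

lemma norm_combination: "(norm (\<alpha> *\<^sub>R (w, 0) + \<beta> *\<^sub>R u))\<^sup>2 = \<alpha>\<^sup>2 * (norm w)\<^sup>2 + \<beta>\<^sup>2"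
proof -
  have "orthogonal (\<alpha> *\<^sub>R (w, 0)) (\<beta> *\<^sub>R u)"
    using orth by (intro orthogonal_clauses) (simp add: orthogonal_def)
  from norm_add_Pythagorean[OF this] show ?thesis
    using u by (simp only: norm_scaleR norm_Pair power_mult_distrib) simp
qed

text \<open>
  Both sides are the square of the distance from \<open>p + w\<close> to the pole, computed along the vertical
  axis and along \<open>u\<close>.
\<close>

lemma norm_section: "(norm (p + w))\<^sup>2 + 1 = D"
proof -
  have "(p + w, 0) - north_pole = (w, 0) - (1 / r) *\<^sub>R u"
    using foot by (auto simp: prod_eq_iff)
  then have "(norm ((p + w, 0) - (north_pole :: (real^'n) \<times> real)))\<^sup>2 = (norm ((w, 0) - (1 / r) *\<^sub>R u))\<^sup>2"
    by simp
  also have "\<dots> = (norm w)\<^sup>2 + (1 / r)\<^sup>2"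
    using norm_combination[of 1 "- (1 / r)"] by simp
  finally show ?thesis
    by (simp add: north_pole_def norm_Pair D_def)
qed

lemma inv_stereographic_section:
  "inv_stereographic (p + w) = c + r *\<^sub>R u + (2 / D) *\<^sub>R ((w, 0) - (1 / r) *\<^sub>R u)"
proof -
  have "(p + w, 0) - north_pole = (w, 0) - (1 / r) *\<^sub>R u"
    using foot by (auto simp: prod_eq_iff)
  then show ?thesis
    unfolding inv_stereographic_eq_inversion norm_section pole by simp
qed

lemma dist_inv_stereographic: "dist (inv_stereographic (p + w)) c = r"
proof -
  have "(dist (inv_stereographic (p + w)) c)\<^sup>2 = (norm ((2 / D) *\<^sub>R (w, 0) + (r - 2 / (D * r)) *\<^sub>R u))\<^sup>2"
    unfolding inv_stereographic_section dist_norm by (simp add: algebra_simps)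
  also have "\<dots> = (2 / D)\<^sup>2 * (norm w)\<^sup>2 + (r - 2 / (D * r))\<^sup>2"
    by (rule norm_combination)
  also have "\<dots> = (2 / D)\<^sup>2 * (D - (1 / r)\<^sup>2) + (r - 2 / (D * r))\<^sup>2"
    by (simp add: D_def)
  also have "\<dots> = r\<^sup>2"
    using D_pos r by (simp add: field_simps power2_eq_square)
  finally show ?thesis
    using r by (metis zero_le_dist less_imp_le power2_eq_iff_nonneg)
qed

text \<open>
  This identifies the chart of \<open>nn_integral_cone_chart\<close>: after translation by \<open>c\<close>,
  its rays run from \<open>c\<close> through the stereographic images of the points \<open>p + w\<close>.
\<close>

lemma cone_point:
  "(a *\<^sub>R w, 0) + (a * ((r * (norm w)\<^sup>2 - 1 / r) / 2)) *\<^sub>R u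
    = (a * D / 2) *\<^sub>R (inv_stereographic (p + w) - c)"
proof -
  have "(a * D / 2) *\<^sub>R (inv_stereographic (p + w) - c)
      = (a * D / 2) *\<^sub>R ((2 / D) *\<^sub>R (w, 0)) + ((a * D / 2) * (r - 2 / (D * r))) *\<^sub>R u"
    unfolding inv_stereographic_section by (simp add: algebra_simps)
  also have "(a * D / 2) *\<^sub>R ((2 / D) *\<^sub>R (w, 0)) = (a *\<^sub>R w, 0 :: real)"
    using D_pos by simp
  also have "(a * D / 2) * (r - 2 / (D * r)) = a * (r * D / 2 - 1 / r)"
    using D_pos by (simp add: field_simps)
  also have "r * D / 2 - 1 / r = (r * (norm w)\<^sup>2 - 1 / r) / 2"
    using r by (simp add: D_def field_simps power2_eq_square)
  finally show ?thesis by simp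
qed

text \<open>
  The part of the ray through \<open>inv_stereographic (p + w)\<close> inside the ball of radius \<open>r\<close> is
  \<open>0 < a < 2 / D\<close>, and the Jacobian there is \<open>a^m r D / 2\<close>.
\<close>

lemma cone_integral:
  "(\<integral>\<^sup>+a. cone_indicator A ((a *\<^sub>R w, 0) + (a * ((r * (norm w)\<^sup>2 - 1 / r) / 2)) *\<^sub>R u)
      * ennreal (a ^ m * ((r * (norm w)\<^sup>2 + 1 / r) / 2)) * indicator {0<..} a \<partial>lborel)
    = ennreal (r / Suc m) * (ennreal ((2 / ((norm (p + w))\<^sup>2 + 1)) ^ m) * indicator A (inv_stereographic (p + w)))"
    (is "(\<integral>\<^sup>+a. ?f a \<partial>lborel) = _")
proof -
  let ?y = "inv_stereographic (p + w)"
  have n: "norm (?y - c) = r" using dist_inv_stereographic by (simp add: dist_norm)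
  have "?f a = indicator A ?y * ennreal (r * D / 2) * (ennreal (a ^ m) * indicator {0<..<2/D} a)" for a
  proof (cases "0 < a")
    case True
    have nv: "norm ((a * D / 2) *\<^sub>R (?y - c)) = a * D / 2 * r"
      using True D_pos n by (simp add: abs_mult)
    have "c + (r / (a * D / 2 * r)) *\<^sub>R ((a * D / 2) *\<^sub>R (?y - c)) = ?y"
      using True D_pos r by simp
    moreover have "(a * D / 2) *\<^sub>R (?y - c) \<in> ball 0 r \<longleftrightarrow> a < 2 / D"
      unfolding mem_ball dist_0_norm nv using D_pos r by (simp add: field_simps)
    moreover have "ennreal (a ^ m * ((r * (norm w)\<^sup>2 + 1 / r) / 2)) = ennreal (a ^ m) * ennreal (r * D / 2)"
    proof -
      have eq: "(r * (norm w)\<^sup>2 + 1 / r) / 2 = r * D / 2"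
        using r by (simp add: D_def field_simps power2_eq_square)
      show ?thesis unfolding eq using True D_pos r by (intro ennreal_mult) auto
    qed
    ultimately show ?thesis
      unfolding cone_point cone_indicator_def nv using True by (auto simp: mult_ac split: split_indicator)
  qed simp
  then have "(\<integral>\<^sup>+a. ?f a \<partial>lborel)
      = indicator A ?y * ennreal (r * D / 2) * (\<integral>\<^sup>+a. ennreal (a ^ m) * indicator {0<..<2/D} a \<partial>lborel)"
    by (simp add: nn_integral_cmult)
  also have "(\<integral>\<^sup>+a. ennreal (a ^ m) * indicator {0<..<2/D} a \<partial>lborel) = ennreal ((2 / D) ^ Suc m / Suc m)"
    using D_pos by (intro nn_integral_power_Ioo) auto
  also have "indicator A ?y * ennreal (r * D / 2) * ennreal ((2 / D) ^ Suc m / Suc m)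
      = indicator A ?y * ennreal (r * D / 2 * ((2 / D) ^ Suc m / Suc m))"
    unfolding mult.assoc using D_pos r by (subst ennreal_mult[symmetric]) (simp_all add: mult.assoc)
  also have "r * D / 2 * ((2 / D) ^ Suc m / Suc m) = (D * (2 / D) / 2) * (r / Suc m * (2 / D) ^ m)"
    by (simp only: power_Suc times_divide_eq_left times_divide_eq_right divide_divide_eq_left mult_ac)
  also have "D * (2 / D) / 2 = 1"
    using D_pos by simp
  also have "1 * (r / Suc m * (2 / D) ^ m) = r / Suc m * (2 / D) ^ m"
    by (rule mult_1)
  also have "ennreal (r / Suc m * (2 / D) ^ m) = ennreal (r / Suc m) * ennreal ((2 / D) ^ m)"
    using D_pos r by (intro ennreal_mult) auto
  finally show ?thesis
    by (simp add: norm_section mult_ac)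
qed

end

text \<open>
  The conformal factor of the inverse stereographic projection is \<open>2 / (|x|\<^sup>2 + 1)\<close>. The proof
  computes the volume of the solid cone over a Borel set: Fubini separates the coordinate along
  \<open>u\<close> from those along \<open>\<zeta>\<close>, and \<open>nn_integral_cone_chart\<close> followed by \<open>cone_integral\<close>
  integrates along the rays.
\<close>

lemma subsphere_borel_eq_stereographic_image:
  fixes e :: "'i \<Rightarrow> real^'n"
  assumes on: "orthonormal_family I e" and ne: "I \<noteq> {}"
    and orth: "\<And>i. i \<in> I \<Longrightarrow> (e i, 0) \<bullet> u = 0"
    and z: "\<zeta> = (\<lambda>v. p + v) ` span (e ` I)"
    and t: "\<tau> = (\<lambda>v. c + v) ` span (insert u ((\<lambda>v. (v, 0)) ` e ` I))"
    and dim: "aff_dim \<tau> = int (Suc (card I))"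
  shows "subsphere_borel \<tau> c r
    = distr (density (plane_lborel \<zeta>) (\<lambda>x. ennreal ((2 / ((norm x)\<^sup>2 + 1)) ^ card I))) borel inv_stereographic"
    (is "?M = distr ?N _ _")
proof (rule measure_eqI)
  show "sets ?M = sets (distr ?N borel inv_stereographic)"
    by (simp add: subsphere_borel_def)
  fix A assume "A \<in> sets ?M"
  then have [measurable]: "A \<in> sets borel" by (simp add: subsphere_borel_def)
  interpret O: product_sigma_finite "\<lambda>_::'i option. lborel :: real measure" ..
  have fin: "finite I" using on by (simp add: orthonormal_family_def)
  \<comment> \<open>The plane \<open>\<tau>\<close> has one more direction than \<open>\<zeta>\<close>. The option type provides an index, \<open>None\<close>, for \<open>u\<close>.\<close>
  define K where "K = Some ` I"
  define E where "E = e \<circ> the"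
  have K: "card K = card I" "finite K" "None \<notin> K" "K \<noteq> {}"
    using fin ne by (auto simp: K_def card_image)
  have EK: "E ` K = e ` I" by (auto simp: E_def K_def image_image)
  have onE: "orthonormal_family K E"
    using on by (auto simp: orthonormal_family_def K_def E_def)
  define E' where "E' j = (case j of None \<Rightarrow> u | Some i \<Rightarrow> (e i, 0))" for j
  have E'K: "E' j = (E j, 0)" if "j \<in> K" for j
    using that by (auto simp: E'_def E_def K_def)
  have onE': "orthonormal_family (insert None K) E'"
    using on inner_u_u orth orth[unfolded inner_commute[of _ u]]
    by (auto simp: orthonormal_family_def K_def E'_def)
  have E'_img: "E' ` insert None K = insert u ((\<lambda>v. (v, 0)) ` e ` I)"
    by (auto simp: K_def E'_def image_image)
  let ?P = "\<Pi>\<^sub>M i\<in>K. (lborel :: real measure)"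
  let ?L = "frame_map K E"
  have plane_z: "plane_lborel \<zeta> = distr ?P borel (\<lambda>t. p + ?L t)"
    by (rule plane_lborel_frame[OF onE]) (simp add: z EK)
  have plane_t: "plane_lborel \<tau>
      = distr (\<Pi>\<^sub>M i\<in>insert None K. lborel) borel (\<lambda>t. c + frame_map (insert None K) E' t)"
    by (rule plane_lborel_frame[OF onE']) (simp only: t E'_img)
  have split: "frame_map (insert None K) E' (t(None := s)) = (?L t, 0) + s *\<^sub>R u" for t s
  proof -
    have "frame_map (insert None K) E' (t(None := s)) = s *\<^sub>R u + (\<Sum>j\<in>K. t j *\<^sub>R (E j, 0))"
      unfolding frame_map_def using K E'K by (auto simp: E'_def[of None] intro!: sum.cong)
    also have "(\<Sum>j\<in>K. t j *\<^sub>R (E j, 0)) = (?L t, 0 :: real)"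
      by (simp add: frame_map_def prod_eq_iff fst_sum snd_sum)
    finally show ?thesis by (simp only: add.commute)
  qed
  have Lu: "(?L t, 0) \<bullet> u = 0" for t
  proof -
    have "?L t \<bullet> fst u = (\<Sum>j\<in>K. t j *\<^sub>R E j \<bullet> fst u)"
      by (simp add: frame_map_def inner_sum_left)
    also have "\<dots> = 0"
      using orth by (intro sum.neutral) (auto simp: K_def E_def inner_prod_def)
    finally show ?thesis by (simp add: inner_prod_def)
  qed
  let ?w = "\<lambda>x::real^'n. ennreal ((2 / ((norm x)\<^sup>2 + 1)) ^ card I)"
  have rad [measurable]: "(\<lambda>y. c + (r / dist y c) *\<^sub>R (y - c)) \<in> restrict_space (plane_lborel \<tau>) (ball c r) \<rightarrow>\<^sub>M borel"
    by (rule measurable_restrict_space1) (simp add: plane_t)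
  have "emeasure ?M A = ennreal (of_int (aff_dim \<tau>) / r)
      * (\<integral>\<^sup>+y. indicator A y \<partial>distr (restrict_space (plane_lborel \<tau>) (ball c r)) borel
          (\<lambda>y. c + (r / dist y c) *\<^sub>R (y - c)))"
    by (simp add: subsphere_borel_def)
  also have "(\<integral>\<^sup>+y. indicator A y \<partial>distr (restrict_space (plane_lborel \<tau>) (ball c r)) borel
          (\<lambda>y. c + (r / dist y c) *\<^sub>R (y - c)))
      = (\<integral>\<^sup>+y. indicator A (c + (r / dist y c) *\<^sub>R (y - c)) \<partial>restrict_space (plane_lborel \<tau>) (ball c r))"
    by (rule nn_integral_distr) (auto intro: rad)
  also have "\<dots> = (\<integral>\<^sup>+y. cone_indicator A (y - c) \<partial>plane_lborel \<tau>)"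
    by (subst nn_integral_restrict_space)
      (auto simp: cone_indicator_def plane_t dist_norm norm_minus_commute split: split_indicator
        intro!: nn_integral_cong)
  also have "\<dots> = (\<integral>\<^sup>+t. cone_indicator A (frame_map (insert None K) E' t) \<partial>(\<Pi>\<^sub>M i\<in>insert None K. lborel))"
    unfolding plane_t by (subst nn_integral_distr) simp_all
  also have "\<dots> = (\<integral>\<^sup>+t. (\<integral>\<^sup>+s. cone_indicator A ((?L t, 0) + s *\<^sub>R u) \<partial>lborel) \<partial>?P)"
    using K by (subst O.product_nn_integral_insert) (simp_all add: split)
  also have "\<dots> = (\<integral>\<^sup>+t. (\<integral>\<^sup>+a. cone_indicator A ((a *\<^sub>R ?L t, 0) + (a * ((r * (norm (?L t))\<^sup>2 - 1 / r) / 2)) *\<^sub>R u)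
      * ennreal (a ^ card I * ((r * (norm (?L t))\<^sup>2 + 1 / r) / 2)) * indicator {0<..} a \<partial>lborel) \<partial>?P)"
  proof -
    have "(\<lambda>x. cone_indicator A ((fst x, 0) + snd x *\<^sub>R u)) \<in> borel_measurable (borel \<Otimes>\<^sub>M borel)"
      by measurable
    then have "(\<lambda>x. cone_indicator A ((fst x, 0) + snd x *\<^sub>R u)) \<in> borel_measurable borel"
      by (simp add: borel_prod)
    from nn_integral_cone_chart[OF onE K(4) r this] show ?thesis
      by (simp add: K(1))
  qed
  also have "\<dots> = (\<integral>\<^sup>+t. ennreal (r / Suc (card I)) * (?w (p + ?L t) * indicator A (inv_stereographic (p + ?L t))) \<partial>?P)"
    by (rule nn_integral_cong) (rule cone_integral[OF Lu])
  also have "\<dots> = ennreal (r / Suc (card I)) * (\<integral>\<^sup>+t. ?w (p + ?L t) * indicator A (inv_stereographic (p + ?L t)) \<partial>?P)"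
    by (rule nn_integral_cmult) measurable
  also have "ennreal (of_int (aff_dim \<tau>) / r) * \<dots>
      = ennreal (of_int (aff_dim \<tau>) / r * (r / Suc (card I)))
        * (\<integral>\<^sup>+t. ?w (p + ?L t) * indicator A (inv_stereographic (p + ?L t)) \<partial>?P)"
    using r dim by (subst ennreal_mult) (auto simp: mult.assoc)
  also have "of_int (aff_dim \<tau>) / r * (r / Suc (card I)) = 1"
    using r by (simp add: dim)
  also have "ennreal 1 * (\<integral>\<^sup>+t. ?w (p + ?L t) * indicator A (inv_stereographic (p + ?L t)) \<partial>?P)
      = (\<integral>\<^sup>+x. ?w x * indicator A (inv_stereographic x) \<partial>plane_lborel \<zeta>)"
    unfolding plane_z by (subst nn_integral_distr) simp_all
  also have "\<dots> = (\<integral>\<^sup>+x. indicator A (inv_stereographic x) \<partial>?N)"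
    by (subst nn_integral_density) (simp_all add: plane_z)
  also have "\<dots> = (\<integral>\<^sup>+y. indicator A y \<partial>distr ?N borel inv_stereographic)"
    by (subst nn_integral_distr) (simp_all add: plane_z)
  also have "\<dots> = emeasure (distr ?N borel inv_stereographic) A" by simp
  finally show "emeasure ?M A = emeasure (distr ?N borel inv_stereographic) A" .
qed

end

section \<open>Adapted frames for slices\<close>

text \<open>
  As \<open>c\<close> is the point of \<open>\<tau>\<close> closest to the origin, it is orthogonal to the directions of
  \<open>\<tau>\<close>, and the pole is orthogonal to the horizontal ones. Hence \<open>N - c\<close> is orthogonal to the
  directions of the equatorial section, and an orthonormal basis of these is completed by \<open>u\<close> to
  one of the directions of \<open>\<tau>\<close>. The radius is positive because \<open>\<tau>\<close> meets \<open>\<real>\<^sup>n\<close>: were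
  \<open>N\<close> itself the closest point, \<open>\<tau>\<close> would be contained in the tangent hyperplane of the sphere
  at \<open>N\<close>, which is parallel to \<open>\<real>\<^sup>n\<close>.
\<close>

lemma slice_frame:
  fixes \<tau> :: "((real^'n) \<times> real) set"
  assumes t: "\<tau> \<in> slice_planes k"
  obtains u p B where
    "slice_coordinates u (slice_centre \<tau>) (slice_radius \<tau>) p"
    "orthonormal_family B id" "\<And>b. b \<in> B \<Longrightarrow> (b, 0) \<bullet> u = 0"
    "equatorial_section \<tau> = (\<lambda>v. p + v) ` span B"
    "\<tau> = (\<lambda>v. slice_centre \<tau> + v) ` span (insert u ((\<lambda>v. (v, 0)) ` B))"
    "k = Suc (card B)"
proof -
  let ?N = "north_pole :: (real^'n) \<times> real" and ?\<iota> = "\<lambda>v::real^'n. (v, 0::real)"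
  define c where "c = slice_centre \<tau>"
  define r where "r = slice_radius \<tau>"
  obtain x0 where aff: "affine \<tau>" and dim: "aff_dim \<tau> = int k" and N: "?N \<in> \<tau>" and x0: "(x0, 0) \<in> \<tau>"
    using t by (auto simp: slice_planes_def)
  have c: "c \<in> \<tau>" and perp: "\<And>y. y \<in> \<tau> \<Longrightarrow> c \<bullet> (y - c) = 0"
    using slice_centre_pythagoras(1,2)[OF aff] N by (auto simp: c_def)
  have normN: "norm ?N = 1" by (simp add: north_pole_def)
  \<comment> \<open>The slice radius is the distance from the centre to the pole, since the pole lies on the slice.\<close>
  have rr: "1 - (norm c)\<^sup>2 = (dist c ?N)\<^sup>2"
    using slice_centre_pythagoras(3)[OF aff N] normN by (simp add: c_def)
  then have r_dist: "r = dist c ?N"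
    by (simp add: r_def slice_radius_def flip: c_def)
  have "c \<noteq> ?N"
  proof
    assume "c = ?N"
    with perp[OF x0] show False by (simp add: north_pole_def inner_prod_def)
  qed
  then have r: "0 < r" by (simp add: r_dist)
  have r2: "1 - (norm c)\<^sup>2 = r\<^sup>2" using rr by (simp add: r_dist)
  define u where "u = (1 / r) *\<^sub>R (?N - c)"
  have u: "norm u = 1" using r by (simp add: u_def r_dist dist_norm norm_minus_commute)
  have pole: "c + r *\<^sub>R u = ?N" using r by (simp add: u_def)
  have "c \<bullet> ?N = (norm c)\<^sup>2"
    using perp[OF N] by (simp add: inner_diff_right power2_norm_eq_inner)
  then have "snd c = (norm c)\<^sup>2" by (simp add: north_pole_def inner_prod_def)
  \<comment> \<open>This equation puts the point at distance \<open>1 / r\<close> below the pole, in direction \<open>- u\<close>, into \<open>\<real>\<^sup>n\<close>.\<close>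
  then have snd_u: "snd u = r"
    using r2 r by (simp add: u_def north_pole_def power2_eq_square)
  define p where "p = fst (?N - (1 / r) *\<^sub>R u)"
  have foot: "(p, 0) = ?N - (1 / r) *\<^sub>R u"
    using r by (simp add: p_def prod_eq_iff snd_u) (simp add: north_pole_def)
  define S where "S = (\<lambda>x. - c + x) ` \<tau>"
  have S: "subspace S" unfolding S_def by (rule affine_diffs_subspace[OF aff c])
  have in_S: "v \<in> S \<longleftrightarrow> c + v \<in> \<tau>" for v
    unfolding S_def by (auto simp: image_iff intro: bexI[of _ "c + v"])
  have "?N - c \<in> S" using N by (simp add: in_S)
  then have uS: "u \<in> S" unfolding u_def by (rule subspace_scale[OF S])
  have lin: "linear ?\<iota>" by (rule linearI) auto
  define V where "V = ?\<iota> -` S"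
  have V: "subspace V" unfolding V_def by (rule linear_subspace_vimage[OF lin S])
  obtain B where B: "pairwise orthogonal B" "\<And>b. b \<in> B \<Longrightarrow> norm b = 1" "span B = V" "B \<subseteq> V" "independent B"
    using orthonormal_basis_subspace[OF V] by metis
  have finB: "finite B" using B(5) by (rule independent_imp_finite)
  have on: "orthonormal_family B id"
    using B(1,2) finB by (auto simp: orthonormal_family_def pairwise_def orthogonal_def dot_square_norm)
  have orth: "(v, 0) \<bullet> u = 0" if "v \<in> V" for v
  proof -
    have "c + (v, 0) \<in> \<tau>" using that by (simp add: V_def in_S)
    from perp[OF this] have "(v, 0) \<bullet> c = 0" by (simp add: inner_commute)
    moreover have "(v, 0) \<bullet> ?N = 0" by (simp add: north_pole_def inner_prod_def)
    ultimately show ?thesis by (simp add: u_def inner_diff_right)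
  qed
  have pc: "(p, 0) - c \<in> S"
  proof -
    have "(p, 0) - c = (r - 1 / r) *\<^sub>R u" unfolding foot pole[symmetric] by (simp add: algebra_simps)
    then show ?thesis using subspace_scale[OF S uS] by simp
  qed
  have zeta: "equatorial_section \<tau> = (\<lambda>v. p + v) ` span B"
  proof (intro set_eqI)
    fix x
    have "x \<in> equatorial_section \<tau> \<longleftrightarrow> (x, 0) - c \<in> S"
      by (simp add: equatorial_section_def in_S)
    also have "\<dots> \<longleftrightarrow> (x - p, 0) \<in> S"
    proof
      assume "(x, 0) - c \<in> S"
      from subspace_diff[OF S this pc] show "(x - p, 0) \<in> S" by simp
    next
      assume "(x - p, 0) \<in> S"
      from subspace_add[OF S this pc] have "(x - p, 0) + ((p, 0) - c) \<in> S" .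
      also have "(x - p, 0) + ((p, 0) - c) = (x, 0) - c" by (simp add: prod_eq_iff)
      finally show "(x, 0) - c \<in> S" .
    qed
    also have "\<dots> \<longleftrightarrow> x \<in> (\<lambda>v. p + v) ` span B"
      unfolding B(3) V_def by (auto simp: image_iff intro!: bexI[of _ "x - p"])
    finally show "x \<in> equatorial_section \<tau> \<longleftrightarrow> x \<in> (\<lambda>v. p + v) ` span B" .
  qed
  have span_img: "span (?\<iota> ` B) = ?\<iota> ` V"
    unfolding B(3)[symmetric] by (rule linear_span_image[OF lin])
  have S_span: "S = span (insert u (?\<iota> ` B))"
  proof
    show "span (insert u (?\<iota> ` B)) \<subseteq> S"
      using uS B(4) by (intro span_minimal S) (auto simp: V_def)
    show "S \<subseteq> span (insert u (?\<iota> ` B))"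
    proof
      fix s assume "s \<in> S"
      then have "s - (snd s / r) *\<^sub>R u \<in> S"
        using S uS by (intro subspace_diff subspace_scale)
      moreover have "s - (snd s / r) *\<^sub>R u = ?\<iota> (fst (s - (snd s / r) *\<^sub>R u))"
        using r by (simp add: prod_eq_iff snd_u)
      ultimately have "s - (snd s / r) *\<^sub>R u \<in> span (?\<iota> ` B)"
        unfolding span_img V_def by (metis image_eqI vimageI)
      then show "s \<in> span (insert u (?\<iota> ` B))"
        unfolding span_insert by blast
    qed
  qed
  have tau: "\<tau> = (\<lambda>v. c + v) ` span (insert u (?\<iota> ` B))"
    unfolding S_span[symmetric] S_def by (simp add: image_image)
  have "u \<notin> span (?\<iota> ` B)"
    unfolding span_img using snd_u r by auto
  then have "dim (insert u (?\<iota> ` B)) = Suc (dim (?\<iota> ` B))"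
    by (simp add: dim_insert)
  also have "dim (?\<iota> ` B) = dim B"
    by (rule dim_image_eq[OF lin]) (auto simp: inj_on_def)
  also have "dim B = card B" by (rule dim_eq_card_independent[OF B(5)])
  finally have "dim S = Suc (card B)" by (simp add: S_span)
  moreover have "aff_dim \<tau> = int (dim S)"
    unfolding S_def by (rule aff_dim_eq_dim) (rule hull_inc[OF c])
  ultimately have "k = Suc (card B)" using dim by simp
  moreover have "slice_coordinates u c r p"
    by standard (fact u r pole foot)+
  ultimately show ?thesis
    using B(4) by (intro that[of u p B, folded c_def r_def, OF _ on orth zeta tau]) auto
qed

theorem theorem3p1:
  fixes f :: "(real^'n) \<times> real \<Rightarrow> 'b::{real_normed_field, banach, second_countable_topology}"
    and g :: "real^'n \<Rightarrow> 'b"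
    and k :: nat
    and \<tau> :: "((real^'n) \<times> real) set"
  assumes "2 \<le> CARD('n)"
    and "2 \<le> k" and "k \<le> CARD('n)"
    and "\<tau> \<in> slice_planes k"
    and "\<And>x. g x = 2 ^ (k - 1) * (f \<circ> inv_stereographic) x
                    / of_real (((norm x)\<^sup>2 + 1) ^ (k - 1))"
    and "slice_transform_exists f \<tau> \<or> radon_john_exists g (equatorial_section \<tau>)"
  shows "slice_transform_exists f \<tau> \<and> radon_john_exists g (equatorial_section \<tau>)
    \<and> slice_transform f \<tau> = radon_john g (equatorial_section \<tau>)"
proof -
  let ?\<zeta> = "equatorial_section \<tau>" and ?c = "slice_centre \<tau>" and ?r = "slice_radius \<tau>"
  have aff: "affine \<tau>" and N: "north_pole \<in> \<tau>"
    using assms(4) by (auto simp: slice_planes_def)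
  obtain u p B where coords: "slice_coordinates u ?c ?r p"
    and on: "orthonormal_family B id" and orth: "\<And>b. b \<in> B \<Longrightarrow> (b, 0) \<bullet> u = 0"
    and zeta: "?\<zeta> = (\<lambda>v. p + v) ` span B"
    and tau: "\<tau> = (\<lambda>v. ?c + v) ` span (insert u ((\<lambda>v. (v, 0)) ` B))"
    and k: "k = Suc (card B)"
    using slice_frame[OF assms(4)] by blast
  define W :: "real^'n \<Rightarrow> real" where "W x = (2 / ((norm x)\<^sup>2 + 1)) ^ (k - 1)" for x
  define M where "M = subsphere_borel \<tau> ?c ?r"
  define P where "P = density (plane_lborel ?\<zeta>) (\<lambda>x. ennreal (W x))"
  have sets_plane [measurable_cong]: "sets (plane_lborel ?\<zeta>) = sets borel"
    using plane_lborel_frame[OF on, of ?\<zeta> p] zeta by simp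
  have [measurable_cong]: "sets P = sets borel" "sets M = sets borel"
    by (simp_all add: P_def M_def sets_plane subsphere_borel_def)
  have "B \<noteq> {}" using k assms(2) by auto
  then have M: "M = distr P borel inv_stereographic"
    unfolding M_def P_def W_def
    using slice_coordinates.subsphere_borel_eq_stereographic_image[OF coords on, of ?\<zeta> \<tau>]
      orth zeta tau k assms(2,4) by (auto simp: slice_planes_def)
  have W_pos: "0 < W x" for x
    unfolding W_def by (intro zero_less_power divide_pos_pos add_nonneg_pos) auto
  have W_meas: "W \<in> borel_measurable (plane_lborel ?\<zeta>)"
    unfolding W_def by measurable
  define F where "F y = indicat_real (\<tau> \<inter> sphere 0 1) y *\<^sub>R f y" for y
  have meas: "inv_stereographic \<in> P \<rightarrow>\<^sub>M M" "stereographic \<in> M \<rightarrow>\<^sub>M P"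
    by measurable
  have distr: "distr P M inv_stereographic = M"
    by (rule trans[OF distr_cong M[symmetric]]) (simp_all add: \<open>sets M = sets borel\<close>)
  have inv: "AE y in M. inv_stereographic (stereographic y) = y"
    unfolding M by (subst AE_distr_iff) simp_all
  note iso = completion_isomorphism[OF meas distr stereographic_inv_stereographic inv, of F]
  note dens = completion_density_transfer[OF W_meas W_pos, of "\<lambda>x. F (inv_stereographic x)", folded P_def]
  \<comment> \<open>The weight turns \<open>f \<circ> inv_stereographic\<close> into \<open>g\<close>, and the preimage of the slice is exactly \<open>\<zeta>\<close>.\<close>
  have WF: "W x *\<^sub>R F (inv_stereographic x) = indicat_real ?\<zeta> x *\<^sub>R g x" for x
  proof -
    have "inv_stereographic x \<in> \<tau> \<inter> sphere 0 1 \<longleftrightarrow> x \<in> ?\<zeta>"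
      using inv_stereographic_in_plane_iff[OF aff N, of x]
      by (simp add: norm_inv_stereographic equatorial_section_def)
    moreover have "W x *\<^sub>R f (inv_stereographic x) = g x"
      unfolding assms(5) W_def by (simp add: scaleR_conv_of_real power_divide)
    ultimately show ?thesis by (simp add: F_def indicator_def)
  qed
  have "slice_transform_exists f \<tau> \<longleftrightarrow> integrable (completion M) F"
    by (simp add: slice_transform_exists_def set_integrable_def slice_measure_def M_def F_def[abs_def])
  also have "\<dots> \<longleftrightarrow> radon_john_exists g ?\<zeta>"
    unfolding iso(1) dens(1) WF
    by (simp add: radon_john_exists_def set_integrable_def plane_lebesgue_def)
  finally have "slice_transform_exists f \<tau> \<longleftrightarrow> radon_john_exists g ?\<zeta>" .
  moreover have "slice_transform f \<tau> = integral\<^sup>L (completion M) F"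
    by (simp add: slice_transform_def set_lebesgue_integral_def slice_measure_def M_def F_def[abs_def])
  then have "slice_transform f \<tau> = radon_john g ?\<zeta>"
    unfolding iso(2) dens(2) WF
    by (simp add: radon_john_def set_lebesgue_integral_def plane_lebesgue_def)
  ultimately show ?thesis using assms(6) by blast
qed

end
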